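(* The type $\mathsf{lang}_\Sigma$ with zero $\emptyset$, one $\epsilon$, and operations $+$, $\cdot$ and ${}^*$ forms a Kleene algebra: $+$ is associative, commutative and idempotent with identity $\emptyset$; $\cdot$ is associative with two-sided identity $\epsilon$; $\cdot$ distributes over $+$ on both sides; $\emptyset$ is a two-sided annihilator for $\cdot$; and, writing $x\le y$ for $x+y=y$, for all $a,b,x$: $\epsilon + a\cdot a^*\le a^*$, $\epsilon + a^*\cdot a\le a^*$, $b + a\cdot x\le x \Rightarrow a^*\cdot b\le x$, and $b + x\cdot a\le x\Rightarrow b\cdot a^*\le x$.
   Context: $\Sigma$ is a fixed finite alphabet. $\mathsf{lang}_\Sigma$ is the coinductive type with single constructor $\mathsf{lnode}\,b\,k$ ($b:\mathbb{B}$, $k:\Sigma\to\mathsf{lang}_\Sigma$), ordered coinductively by $\mathsf{lnode}\,b_1\,f\sqsubseteq\mathsf{lnode}\,b_2\,g$ if $b_1\sqsubseteq b_2$ (with $\mathbf{false}\sqsubseteq\mathbf{true}$) and $f\,a\sqsubseteq g\,a$ for all $a$; order-equivalent languages are assumed equal (axiom). $\mathsf{o}(\mathsf{lnode}\,b\,\_)=b$, $\delta_{\mathsf{lnode}\,\_\,k}\,x = k\,x$. Corecursively: $\emptyset=\mathsf{lnode}\,\mathbf{false}\,(\lambda\_.\emptyset)$; $\epsilon=\mathsf{lnode}\,\mathbf{true}\,(\lambda\_.\emptyset)$; $a+b=\mathsf{lnode}(\mathsf{o}\,a\lor\mathsf{o}\,b)(\lambda x.\,\delta_a x+\delta_b x)$.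 Basis: the inductive type $\mathsf{tlang}_\Sigma$ with constructors $\bot$ and $\mathsf{tlnode}\,b\,k$ ($k:\Sigma\to\mathsf{tlang}_\Sigma$); $\mathsf{is\_bot}$ holds of $\bot$ and of $\mathsf{tlnode}\,\mathbf{false}\,k$ when it holds of all $k\,a$; order: $t_1\sqsubseteq t_2$ if $\mathsf{is\_bot}\,t_1$, or $t_1=\mathsf{tlnode}\,b_1\,f$, $t_2=\mathsf{tlnode}\,b_2\,g$ with $b_1\sqsubseteq b_2$ and $f\,a\sqsubseteq g\,a$ for all $a$. $\mathsf{idl}\,l\,0=\bot$, $\mathsf{idl}(\mathsf{lnode}\,b\,k)(i+1)=\mathsf{tlnode}\,b\,(\lambda x.\,\mathsf{idl}(k\,x)\,i)$. For monotone $h:\mathsf{tlang}_\Sigma\to C$, $\overline h(l):=\sup_i h(\mathsf{idl}\,l\,i)$ (chosen supremum). $\mathsf{fold}\,z\,f$ on $\mathsf{tlang}_\Sigma$: $\bot\mapsto z$, $\mathsf{tlnode}\,b\,k\mapsto f\,b\,(\mathsf{fold}\,z\,f\circ k)$. $\mathsf{tconcat}:=\mathsf{fold}\,(\lambda\_.\emptyset)\,(\lambda b\,k\,l.\,\mathsf{lnode}(b\land\mathsf{o}\,l)(\lambda x.\,k\,x\,l + (\text{if }b\text{ then }\delta_l x\text{ else }\emptyset))) : \mathsf{tlang}_\Sigma\to(\mathsf{lang}_\Sigma\to\mathsf{lang}_\Sigma)$ (codomain ordered pointwise) and $a\cdot b := \overline{\mathsf{tconcat}}\,a\,b$. Conats: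 coinductive $\mathsf{cozero}$, $\mathsf{cosucc}$, with $\omega=\mathsf{cosucc}\,\omega$, basis $\mathbb{N}$ with $\mathsf{idl}\,n\,0=0$, $\mathsf{idl}\,\mathsf{cozero}\,(i+1)=0$, $\mathsf{idl}(\mathsf{cosucc}\,n)(i+1)=\mathsf{idl}\,n\,i+1$. $\mathsf{iter}\,z\,F\,0=z$, $\mathsf{iter}\,z\,F\,(n+1)=F(\mathsf{iter}\,z\,F\,n)$; $\mathsf{coiter}\,F:=\overline{\mathsf{iter}\,\emptyset\,F}$ (extension over the conat basis). $a^* := \mathsf{coiter}\,(\lambda b.\,\mathsf{lnode}\,\mathbf{true}\,(\lambda x.\,\delta_a x\cdot b))\,\omega$. *)

theory Defs
  imports "HOL-Library.Lub_Glb"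
begin

codatatype 'a lang = lnode (out: bool) (deriv: "'a \<Rightarrow> 'a lang")

coinductive lang_le :: "'a lang \<Rightarrow> 'a lang \<Rightarrow> bool" where
  "b1 \<le> b2 \<Longrightarrow> (\<And>a. lang_le (f a) (g a)) \<Longrightarrow> lang_le (lnode b1 f) (lnode b2 g)"

lemma lang_le_iff:
  "lang_le l m \<longleftrightarrow> out l \<le> out m \<and> (\<forall>a. lang_le (deriv l a) (deriv m a))"
  by (cases l; cases m) (auto elim: lang_le.cases intro: lang_le.intros)

lemma lang_le_coinduct_sel:
  assumes "R l m"
    and "\<And>l m. R l m \<Longrightarrow> out l \<le> out m \<and> (\<forall>a. R (deriv l a) (deriv m a))"
  shows "lang_le l m"
  using assms(1)
proof (coinduction arbitrary: l m)
  case lang_le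
  then show ?case
    using assms(2)[of l m] by (cases l; cases m) auto
qed

lemma lang_le_refl: "lang_le l l"
  by (rule lang_le_coinduct_sel[where R = "(=)"]) auto

lemma lang_le_trans:
  assumes "lang_le l m" "lang_le m n"
  shows "lang_le l n"
proof (rule lang_le_coinduct_sel[where R = "\<lambda>l n. \<exists>m. lang_le l m \<and> lang_le m n"])
  show "\<exists>m. lang_le l m \<and> lang_le m n"
    using assms by blast
next
  fix l n :: "'a lang"
  assume "\<exists>m. lang_le l m \<and> lang_le m n"
  then obtain m where "lang_le l m" "lang_le m n" by blast
  then show "out l \<le> out n \<and> (\<forall>a. \<exists>m. lang_le (deriv l a) m \<and> lang_le m (deriv n a))"
    by (meson lang_le_iff order_trans)
qed

lemma lang_le_antisym:
  assumes "lang_le l m" "lang_le m l"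
  shows "l = m"
  using assms
proof (coinduction arbitrary: l m)
  case Eq_lang
  then show ?case
    using lang_le_iff[of l m] lang_le_iff[of m l] by (auto simp: rel_fun_def)
qed

instantiation lang :: (type) order
begin

definition less_eq_lang :: "'a lang \<Rightarrow> 'a lang \<Rightarrow> bool" where
  "less_eq_lang = lang_le"

definition less_lang :: "'a lang \<Rightarrow> 'a lang \<Rightarrow> bool" where
  "less_lang l m \<longleftrightarrow> l \<le> m \<and> \<not> m \<le> l"

instance
  by standard
    (auto simp: less_eq_lang_def less_lang_def lang_le_refl
      intro: lang_le_trans lang_le_antisym)

end

primcorec lempty :: "'a lang" where
  "lempty = lnode False (\<lambda>_. lempty)"

definition leps :: "'a lang" where
  "leps = lnode True (\<lambda>_. lempty)"

primcorec lplus :: "'a lang \<Rightarrow> 'a lang \<Rightarrow> 'a lang" (infixl \<open>\<^bold>+\<close> 65) where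
  "a \<^bold>+ b = lnode (out a \<or> out b) (\<lambda>x. deriv a x \<^bold>+ deriv b x)"

datatype 'a tlang = TBot | tlnode bool "'a \<Rightarrow> 'a tlang"

inductive is_bot :: "'a tlang \<Rightarrow> bool" where
  "is_bot TBot"
| "(\<And>a. is_bot (k a)) \<Longrightarrow> is_bot (tlnode False k)"

inductive tlang_le :: "'a tlang \<Rightarrow> 'a tlang \<Rightarrow> bool" where
  bot: "is_bot t1 \<Longrightarrow> tlang_le t1 t2"
| node: "b1 \<le> b2 \<Longrightarrow> (\<And>a. tlang_le (f a) (g a)) \<Longrightarrow> tlang_le (tlnode b1 f) (tlnode b2 g)"

lemma is_bot_tlnode: "is_bot (tlnode b k) \<longleftrightarrow> \<not> b \<and> (\<forall>a. is_bot (k a))"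
  by (cases b) (auto elim: is_bot.cases intro: is_bot.intros)

lemma tlang_le_refl: "tlang_le t t"
  by (induction t) (auto intro: tlang_le.intros is_bot.intros)

lemma tlang_le_is_bot: "tlang_le s t \<Longrightarrow> is_bot t \<Longrightarrow> is_bot s"
  by (induction rule: tlang_le.induct) (auto simp: is_bot_tlnode)

lemma tlang_le_trans: "tlang_le s t \<Longrightarrow> tlang_le t u \<Longrightarrow> tlang_le s u"
proof (induction arbitrary: u rule: tlang_le.induct)
  case (bot t1 t2)
  then show ?case by (simp add: tlang_le.bot)
next
  case (node b1 b2 f g)
  from node.prems show ?case
  proof (cases rule: tlang_le.cases)
    case bot
    have "tlang_le (tlnode b1 f) (tlnode b2 g)"
      using node.hyps by (intro tlang_le.node) auto
    with bot show ?thesis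
      by (intro tlang_le.bot) (rule tlang_le_is_bot)
  next
    case (node b2' h)
    with \<open>b1 \<le> b2\<close> node.IH show ?thesis
      by (auto intro!: tlang_le.node)
  qed
qed

text \<open>Only a preorder: distinct trees satisfying \<^const>\<open>is_bot\<close> are equivalent.\<close>

instantiation tlang :: (type) preorder
begin

definition less_eq_tlang :: "'a tlang \<Rightarrow> 'a tlang \<Rightarrow> bool" where
  "less_eq_tlang = tlang_le"

definition less_tlang :: "'a tlang \<Rightarrow> 'a tlang \<Rightarrow> bool" where
  "less_tlang s t \<longleftrightarrow> s \<le> t \<and> \<not> t \<le> s"

instance
  by standard
    (auto simp: less_eq_tlang_def less_tlang_def tlang_le_refl intro: tlang_le_trans)

end

primrec idl_lang :: "'a lang \<Rightarrow> nat \<Rightarrow> 'a tlang" where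
  "idl_lang l 0 = TBot"
| "idl_lang l (Suc i) = tlnode (out l) (\<lambda>x. idl_lang (deriv l x) i)"

definition chosen_sup :: "(nat \<Rightarrow> 'c::order) \<Rightarrow> 'c" where
  "chosen_sup c = (SOME s. isLub UNIV (range c) s)"

text \<open>The extension of a monotone \<open>h\<close> along the basis. It is only meaningful if the suprema
  exist, which \<open>lang_has_Lub\<close> and \<open>lang_fun_has_Lub\<close> below guarantee for the codomains used
  here.\<close>

definition ext_lang :: "('a tlang \<Rightarrow> 'c::order) \<Rightarrow> 'a lang \<Rightarrow> 'c" where
  "ext_lang h l = chosen_sup (\<lambda>i. h (idl_lang l i))"

primcorec lang_Union :: "'a lang set \<Rightarrow> 'a lang" where
  "lang_Union S = lnode (\<exists>l\<in>S. out l) (\<lambda>x. lang_Union ((\<lambda>l. deriv l x) ` S))"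

lemma lang_has_Lub: "isLub UNIV S (lang_Union S)" for S :: "'a lang set"
proof (rule isLubI2)
  show "isUb UNIV S (lang_Union S)"
  proof (rule isUbI; (rule setleI, intro ballI)?)
    fix l assume "l \<in> S"
    have "lang_le l (lang_Union S)"
      by (rule lang_le_coinduct_sel[where R = "\<lambda>l m. \<exists>S. l \<in> S \<and> m = lang_Union S"])
        (use \<open>l \<in> S\<close> in auto)
    then show "l \<le> lang_Union S" by (simp add: less_eq_lang_def)
  qed simp
next
  show "lang_Union S <=* Collect (isUb UNIV S)"
  proof (rule setgeI, intro ballI)
    fix m assume "m \<in> Collect (isUb UNIV S)"
    then have ub: "\<forall>l\<in>S. lang_le l m"
      by (auto simp: isUb_def setle_def less_eq_lang_def)
    have "lang_le (lang_Union S) m"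
    proof (rule lang_le_coinduct_sel[where R = "\<lambda>n m. \<exists>S. n = lang_Union S \<and> (\<forall>l\<in>S. lang_le l m)"])
      fix n m :: "'a lang"
      assume "\<exists>S. n = lang_Union S \<and> (\<forall>l\<in>S. lang_le l m)"
      then obtain S where n: "n = lang_Union S" and S: "\<forall>l\<in>S. lang_le l m" by blast
      have "\<forall>l\<in>S. out l \<le> out m \<and> (\<forall>a. lang_le (deriv l a) (deriv m a))"
        using S lang_le_iff by blast
      then show "out n \<le> out m \<and>
          (\<forall>a. \<exists>S. deriv n a = lang_Union S \<and> (\<forall>l\<in>S. lang_le l (deriv m a)))"
        by (auto simp: n intro!: exI[of _ "(\<lambda>l. deriv l a) ` S" for a])
    qed (use ub in blast)
    then show "lang_Union S \<le> m" by (simp add: less_eq_lang_def)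
  qed
qed

lemma lang_fun_has_Lub: "isLub UNIV F (\<lambda>l. lang_Union ((\<lambda>h. h l) ` F))"
  for F :: "('b \<Rightarrow> 'a lang) set"
proof -
  have ub: "h l \<le> lang_Union ((\<lambda>h. h l) ` F)" if "h \<in> F" for h l
    using lang_has_Lub[of "(\<lambda>h. h l) ` F"] that by (auto dest!: isLubD1 simp: setle_def)
  have least: "lang_Union ((\<lambda>h. h l) ` F) \<le> u l" if "\<forall>h\<in>F. h \<le> u" for u l
    using lang_has_Lub[of "(\<lambda>h. h l) ` F"] that
    by (intro isLub_le_isUb[where R = UNIV]) (auto simp: isUb_def setle_def le_fun_def)
  show ?thesis
    using ub least by (auto simp: isLub_def leastP_def isUb_def setle_def setge_def le_fun_def)
qed

primrec tfold :: "'c \<Rightarrow> (bool \<Rightarrow> ('a \<Rightarrow> 'c) \<Rightarrow> 'c) \<Rightarrow> 'a tlang \<Rightarrow> 'c" where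
  "tfold z f TBot = z"
| "tfold z f (tlnode b k) = f b (tfold z f \<circ> k)"

definition tconcat :: "'a tlang \<Rightarrow> 'a lang \<Rightarrow> 'a lang" where
  "tconcat = tfold (\<lambda>_. lempty)
     (\<lambda>b k l. lnode (b \<and> out l) (\<lambda>x. k x l \<^bold>+ (if b then deriv l x else lempty)))"

lemma lempty_le: "lang_le lempty l"
  by (rule lang_le_coinduct_sel[where R = "\<lambda>n m. n = lempty"]) auto

lemma lplus_lempty: "l \<^bold>+ lempty = l"
  by (coinduction arbitrary: l) (auto simp: rel_fun_def)

lemma lplus_mono: "lang_le a b \<Longrightarrow> lang_le c d \<Longrightarrow> lang_le (a \<^bold>+ c) (b \<^bold>+ d)"
proof (rule lang_le_coinduct_sel[where
      R = "\<lambda>n m. \<exists>a b c d. n = a \<^bold>+ c \<and> m = b \<^bold>+ d \<and> lang_le a b \<and> lang_le c d"])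
  fix n m :: "'a lang"
  assume "\<exists>a b c d. n = a \<^bold>+ c \<and> m = b \<^bold>+ d \<and> lang_le a b \<and> lang_le c d"
  then obtain a b c d where "n = a \<^bold>+ c" "m = b \<^bold>+ d" "lang_le a b" "lang_le c d"
    by blast
  then show "out n \<le> out m \<and> (\<forall>x. \<exists>a b c d. deriv n x = a \<^bold>+ c \<and> deriv m x = b \<^bold>+ d \<and>
      lang_le a b \<and> lang_le c d)"
    using lang_le_iff[of a b] lang_le_iff[of c d] by auto (blast+)
qed blast

lemma tconcat_is_bot: "is_bot t \<Longrightarrow> tconcat t l = lempty"
proof (induction rule: is_bot.induct)
  case 1
  show ?case by (simp add: tconcat_def)
next
  case (2 k)
  then show ?case
    by (subst lempty.code) (simp add: tconcat_def lplus_lempty)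
qed

lemma mono_tconcat: "monotone (\<le>) (\<le>) (tconcat :: 'a tlang \<Rightarrow> _)"
proof (rule monotoneI)
  fix s t :: "'a tlang"
  assume "s \<le> t"
  then have "tlang_le s t" by (simp add: less_eq_tlang_def)
  then have "lang_le (tconcat s l) (tconcat t l)" for l
  proof (induction rule: tlang_le.induct)
    case (bot t1 t2)
    then show ?case by (simp add: tconcat_is_bot lempty_le)
  next
    case (node b1 b2 f g)
    then show ?case
      by (auto simp: tconcat_def le_bool_def intro!: lang_le.intros lplus_mono lang_le_refl lempty_le)
  qed
  then show "tconcat s \<le> tconcat t" by (simp add: le_fun_def less_eq_lang_def)
qed

definition lconcat :: "'a lang \<Rightarrow> 'a lang \<Rightarrow> 'a lang" (infixl \<open>\<^bold>\<cdot>\<close> 70) where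
  "a \<^bold>\<cdot> b = ext_lang tconcat a b"

codatatype conat = cozero | cosucc conat

primcorec conat_omega :: conat where
  "conat_omega = cosucc conat_omega"

primrec idl_conat :: "conat \<Rightarrow> nat \<Rightarrow> nat" where
  "idl_conat n 0 = 0"
| "idl_conat n (Suc i) = (case n of cozero \<Rightarrow> 0 | cosucc m \<Rightarrow> idl_conat m i + 1)"

definition ext_conat :: "(nat \<Rightarrow> 'c::order) \<Rightarrow> conat \<Rightarrow> 'c" where
  "ext_conat h n = chosen_sup (\<lambda>i. h (idl_conat n i))"

primrec iter :: "'c \<Rightarrow> ('c \<Rightarrow> 'c) \<Rightarrow> nat \<Rightarrow> 'c" where
  "iter z F 0 = z"
| "iter z F (Suc n) = F (iter z F n)"

definition coiter :: "('a lang \<Rightarrow> 'a lang) \<Rightarrow> conat \<Rightarrow> 'a lang" where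
  "coiter F = ext_conat (iter lempty F)"

definition lstar :: "'a lang \<Rightarrow> 'a lang" (\<open>_\<^sup>\<star>\<close> [1000] 999) where
  "a\<^sup>\<star> = coiter (\<lambda>b. lnode True (\<lambda>x. deriv a x \<^bold>\<cdot> b)) conat_omega"

text \<open>The order of the Kleene algebra, defined from addition; a priori unrelated to \<open>\<le>\<close> on
  languages.\<close>

definition kleene_le :: "'a lang \<Rightarrow> 'a lang \<Rightarrow> bool" (infix \<open>\<preceq>\<close> 50) where
  "x \<preceq> y \<longleftrightarrow> x \<^bold>+ y = y"

end

theory Submission
  imports Defs
begin

text \<open>A language is determined by the set of words it accepts. Under this identification the
  extensions along the bases become the usual operations on word languages: every prefix of a
  word has finite length, so the approximation \<open>idl_lang a i\<close> loses exactly the words of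
  length at least \<open>i\<close>, and the supremum over \<open>i\<close> recovers concatenation. The iterates defining
  \<open>a\<^sup>\<star>\<close> only ever peel off non-empty factors, but empty factors do not contribute to a
  concatenation, so their supremum accepts exactly the concatenations of words of \<open>a\<close>. The
  Kleene algebra laws then are statements about words and lists of words.\<close>

primrec accepts :: "'a lang \<Rightarrow> 'a list \<Rightarrow> bool" where
  "accepts l [] \<longleftrightarrow> out l"
| "accepts l (x # w) \<longleftrightarrow> accepts (deriv l x) w"

text \<open>Accepting the same words is a bisimulation: the word \<open>[]\<close> compares the
  outputs, the words \<open>x # w\<close> compare the derivatives by \<open>x\<close>.\<close>

lemma lang_eqI:
  assumes "\<And>w. accepts l w \<longleftrightarrow> accepts m w"
  shows "l = m"
  using assms
proof (coinduction arbitrary: l m)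
  case Eq_lang
  have "out l = out m"
    using Eq_lang[rule_format, of "[]"] by simp
  moreover have "accepts (deriv l x) w \<longleftrightarrow> accepts (deriv m x) w" for x w
    using Eq_lang[rule_format, of "x # w"] by simp
  ultimately show ?case
    by (auto simp: rel_fun_def)
qed

lemma accepts_lempty [simp]: "\<not> accepts lempty w"
  by (induction w) auto

lemma accepts_leps [simp]: "accepts leps w \<longleftrightarrow> w = []"
  by (cases w) (auto simp: leps_def)

lemma accepts_lplus [simp]: "accepts (a \<^bold>+ b) w \<longleftrightarrow> accepts a w \<or> accepts b w"
  by (induction w arbitrary: a b) auto

lemma accepts_lang_Union [simp]: "accepts (lang_Union S) w \<longleftrightarrow> (\<exists>l\<in>S. accepts l w)"
  by (induction w arbitrary: S) auto

lemma kleene_le_iff: "a \<preceq> b \<longleftrightarrow> (\<forall>w. accepts a w \<longrightarrow> accepts b w)"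
proof
  assume "a \<preceq> b"
  then show "\<forall>w. accepts a w \<longrightarrow> accepts b w"
    unfolding kleene_le_def by (metis accepts_lplus)
next
  assume "\<forall>w. accepts a w \<longrightarrow> accepts b w"
  then show "a \<preceq> b"
    unfolding kleene_le_def by (intro lang_eqI) auto
qed

text \<open>Least upper bounds are unique by antisymmetry, so the choice operator can only return
  the explicit bound at hand.\<close>

lemma chosen_sup_eqI:
  assumes "isLub UNIV (range c) s"
  shows "chosen_sup c = s"
  unfolding chosen_sup_def
proof (rule some_equality)
  fix t
  assume "isLub UNIV (range c) t"
  with assms show "t = s"
    by (meson antisym isLub_isUb isLub_le_isUb)
qed (rule assms)

text \<open>Case split on whether the first factor is empty or takes the letter \<open>x\<close>; it
  matches the two summands in the derivative of a concatenation.\<close>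

lemma ex_Cons_eq_append_iff:
  "(\<exists>u v. x # w = u @ v \<and> P u v) \<longleftrightarrow> P [] (x # w) \<or> (\<exists>u v. w = u @ v \<and> P (x # u) v)"
  (is "?L \<longleftrightarrow> ?R")
proof
  assume ?L
  then show ?R by (auto simp: Cons_eq_append_conv)
next
  assume ?R
  then show ?L by (metis append_Cons append_Nil)
qed

text \<open>The bound is strict because \<open>TBot\<close> at level 0 rejects even the empty
  prefix; each further level reveals one more letter of \<open>a\<close>.\<close>

lemma accepts_tconcat_idl_lang:
  "accepts (tconcat (idl_lang a i) b) w \<longleftrightarrow>
    (\<exists>u v. w = u @ v \<and> length u < i \<and> accepts a u \<and> accepts b v)"
proof (induction i arbitrary: a w)
  case 0
  then show ?case by (simp add: tconcat_def)
next
  case (Suc i)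
  have unfold: "tconcat (idl_lang a (Suc i)) b = lnode (out a \<and> out b)
      (\<lambda>x. tconcat (idl_lang (deriv a x) i) b \<^bold>+ (if out a then deriv b x else lempty))"
    by (simp add: tconcat_def)
  show ?case
  proof (cases w)
    case Nil
    \<comment> \<open>The equations of \<open>idl_lang\<close> are removed since they would rewrite
      the argument before \<open>unfold\<close> could match.\<close>
    then show ?thesis by (simp add: unfold del: idl_lang.simps)
  next
    case (Cons x w')
    have "accepts (tconcat (idl_lang a (Suc i)) b) w \<longleftrightarrow>
        (\<exists>u v. w' = u @ v \<and> length u < i \<and> accepts (deriv a x) u \<and> accepts b v) \<or>
        out a \<and> accepts (deriv b x) w'"
      by (simp add: unfold Cons Suc.IH del: idl_lang.simps)
    also have "\<dots> \<longleftrightarrow> (\<exists>u v. w = u @ v \<and> length u < Suc i \<and> accepts a u \<and> accepts b v)"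
      unfolding Cons ex_Cons_eq_append_iff by auto
    finally show ?thesis .
  qed
qed

lemma accepts_lconcat:
  "accepts (a \<^bold>\<cdot> b) w \<longleftrightarrow> (\<exists>u v. w = u @ v \<and> accepts a u \<and> accepts b v)"
proof -
  \<comment> \<open>Suprema of functions are pointwise unions, and level \<open>length u + 1\<close>
    admits a given prefix \<open>u\<close>.\<close>
  have "a \<^bold>\<cdot> b = lang_Union ((\<lambda>h. h b) ` range (\<lambda>i. tconcat (idl_lang a i)))"
    unfolding lconcat_def ext_lang_def by (subst chosen_sup_eqI[OF lang_fun_has_Lub]) simp
  then show ?thesis
    by (auto simp: accepts_tconcat_idl_lang)
qed

lemma idl_conat_omega [simp]: "idl_conat conat_omega i = i"
  by (induction i) (subst conat_omega.code, simp)+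

lemma accepts_coiter_omega:
  "accepts (coiter F conat_omega) w \<longleftrightarrow> (\<exists>n. accepts (iter lempty F n) w)"
  by (simp add: coiter_def ext_conat_def chosen_sup_eqI[OF lang_has_Lub])

text \<open>The factor from \<open>a\<close> is non-empty because it contains the letter
  \<open>x\<close> by which \<open>a\<close> is derived; \<open>out a\<close> is never
  consulted.\<close>

lemma accepts_star_step:
  "accepts (lnode True (\<lambda>x. deriv a x \<^bold>\<cdot> b)) w \<longleftrightarrow>
    w = [] \<or> (\<exists>u v. w = u @ v \<and> u \<noteq> [] \<and> accepts a u \<and> accepts b v)"
proof (cases w)
  case (Cons x w')
  then show ?thesis
    by (simp add: accepts_lconcat ex_Cons_eq_append_iff)
qed simp

lemma accepts_lstar:
  "accepts (a\<^sup>\<star>) w \<longleftrightarrow> (\<exists>ws. w = concat ws \<and> (\<forall>u\<in>set ws. accepts a u))"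
proof -
  define F where "F = (\<lambda>b. lnode True (\<lambda>x. deriv a x \<^bold>\<cdot> b))"
  have F: "accepts (F b) w \<longleftrightarrow>
      w = [] \<or> (\<exists>u v. w = u @ v \<and> u \<noteq> [] \<and> accepts a u \<and> accepts b v)" for b w
    unfolding F_def by (rule accepts_star_step)
  have "\<exists>ws. w = concat ws \<and> (\<forall>u\<in>set ws. accepts a u)"
    if "accepts (iter lempty F n) w" for n w
    using that
  proof (induction n arbitrary: w)
    case (Suc n)
    then consider "w = []"
      | u v where "w = u @ v" "accepts a u" "accepts (iter lempty F n) v"
      by (auto simp: F)
    then show ?case
    proof cases
      case 1
      then show ?thesis by (intro exI[of _ "[]"]) simp
    next
      case 2
      with Suc.IH obtain ws where "v = concat ws" "\<forall>u\<in>set ws. accepts a u"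
        by blast
      with 2 show ?thesis by (intro exI[of _ "u # ws"]) simp
    qed
  qed simp
  moreover have "\<exists>n. accepts (iter lempty F n) (concat ws)"
    if "\<forall>u\<in>set ws. accepts a u" for ws
    using that
  proof (induction ws)
    case Nil
    \<comment> \<open>Iterate 0 is \<open>lempty\<close>, which rejects \<open>[]\<close>, so one
      application of \<open>F\<close> is needed.\<close>
    have "accepts (iter lempty F (Suc 0)) []"
      using F[of _ "[]"] by simp
    then show ?case unfolding concat.simps by (rule exI)
  next
    case (Cons u ws)
    then obtain n where n: "accepts (iter lempty F n) (concat ws)"
      by auto
    show ?case
    proof (cases "u = []")
      \<comment> \<open>An empty factor leaves the concatenation unchanged, so the same iterate
        still works.\<close>
      case True
      with n show ?thesis by auto
    next
      case False
      with n Cons.prems have "accepts (iter lempty F (Suc n)) (concat (u # ws))"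
        by (auto simp: F)
      then show ?thesis by blast
    qed
  qed
  ultimately show ?thesis
    unfolding lstar_def F_def[symmetric] accepts_coiter_omega by blast
qed

lemma lconcat_assoc: "a \<^bold>\<cdot> (b \<^bold>\<cdot> c) = (a \<^bold>\<cdot> b) \<^bold>\<cdot> c"
proof (rule lang_eqI)
  fix w
  show "accepts (a \<^bold>\<cdot> (b \<^bold>\<cdot> c)) w \<longleftrightarrow> accepts ((a \<^bold>\<cdot> b) \<^bold>\<cdot> c) w"
    unfolding accepts_lconcat by (metis append.assoc)
qed

lemma out_lstar: "out (a\<^sup>\<star>)"
  unfolding accepts.simps(1)[symmetric] accepts_lstar by (intro exI[of _ "[]"]) simp

lemma lstar_unfold_left: "leps \<^bold>+ a \<^bold>\<cdot> a\<^sup>\<star> \<preceq> a\<^sup>\<star>"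
proof -
  have "accepts (a\<^sup>\<star>) (u @ v)" if "accepts a u" "accepts (a\<^sup>\<star>) v" for u v
  proof -
    from that(2) obtain ws where "v = concat ws" "\<forall>u\<in>set ws. accepts a u"
      unfolding accepts_lstar by blast
    with that(1) show ?thesis
      unfolding accepts_lstar by (intro exI[of _ "u # ws"]) simp
  qed
  then show ?thesis
    by (auto simp: kleene_le_iff accepts_lconcat out_lstar)
qed

lemma lstar_unfold_right: "leps \<^bold>+ a\<^sup>\<star> \<^bold>\<cdot> a \<preceq> a\<^sup>\<star>"
proof -
  have "accepts (a\<^sup>\<star>) (v @ u)" if "accepts (a\<^sup>\<star>) v" "accepts a u" for u v
  proof -
    from that(1) obtain ws where "v = concat ws" "\<forall>u\<in>set ws. accepts a u"
      unfolding accepts_lstar by blast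
    with that(2) show ?thesis
      unfolding accepts_lstar by (intro exI[of _ "ws @ [u]"]) auto
  qed
  then show ?thesis
    by (auto simp: kleene_le_iff accepts_lconcat out_lstar)
qed

lemma lstar_induct_left:
  assumes "b \<^bold>+ a \<^bold>\<cdot> x \<preceq> x"
  shows "a\<^sup>\<star> \<^bold>\<cdot> b \<preceq> x"
proof -
  have b: "accepts x w" if "accepts b w" for w
    using assms that by (simp add: kleene_le_iff)
  have a: "accepts x (u @ v)" if "accepts a u" "accepts x v" for u v
    using assms that by (auto simp: kleene_le_iff accepts_lconcat)
  \<comment> \<open>The factors are prepended to \<open>v\<close> one by one, the last one first,
    each staying in \<open>x\<close> by \<open>a\<close>.\<close>
  have "accepts x (concat ws @ v)" if "\<forall>u\<in>set ws. accepts a u" "accepts b v" for ws v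
    using that by (induction ws) (auto intro: a b)
  then show ?thesis
    by (auto simp: kleene_le_iff accepts_lconcat accepts_lstar)
qed

lemma lstar_induct_right:
  assumes "b \<^bold>+ x \<^bold>\<cdot> a \<preceq> x"
  shows "b \<^bold>\<cdot> a\<^sup>\<star> \<preceq> x"
proof -
  have b: "accepts x w" if "accepts b w" for w
    using assms that by (simp add: kleene_le_iff)
  have a: "accepts x (u @ v)" if "accepts x u" "accepts a v" for u v
    using assms that by (auto simp: kleene_le_iff accepts_lconcat)
  \<comment> \<open>Here \<open>v\<close> is an accumulator that absorbs the factors from the left.
    It is only assumed to lie in \<open>x\<close>, since \<open>v @ u\<close> need not lie in
    \<open>b\<close>.\<close>
  have "accepts x (v @ concat ws)" if "\<forall>u\<in>set ws. accepts a u" "accepts x v" for ws v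
    using that
  proof (induction ws arbitrary: v)
    case (Cons u ws)
    then show ?case
      using a[of v u] Cons.IH[of "v @ u"] by simp
  qed simp
  then show ?thesis
    by (auto simp: kleene_le_iff accepts_lconcat accepts_lstar intro: b)
qed

theorem mainTheorem5:
  fixes a b c x :: "'a::finite lang"
  shows "a \<^bold>+ (b \<^bold>+ c) = (a \<^bold>+ b) \<^bold>+ c
    \<and> a \<^bold>+ b = b \<^bold>+ a
    \<and> a \<^bold>+ a = a
    \<and> a \<^bold>+ lempty = a
    \<and> lempty \<^bold>+ a = a
    \<and> a \<^bold>\<cdot> (b \<^bold>\<cdot> c) = (a \<^bold>\<cdot> b) \<^bold>\<cdot> c
    \<and> a \<^bold>\<cdot> leps = a
    \<and> leps \<^bold>\<cdot> a = a
    \<and> a \<^bold>\<cdot> (b \<^bold>+ c) = a \<^bold>\<cdot> b \<^bold>+ a \<^bold>\<cdot> c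
    \<and> (a \<^bold>+ b) \<^bold>\<cdot> c = a \<^bold>\<cdot> c \<^bold>+ b \<^bold>\<cdot> c
    \<and> a \<^bold>\<cdot> lempty = lempty
    \<and> lempty \<^bold>\<cdot> a = lempty
    \<and> leps \<^bold>+ a \<^bold>\<cdot> a\<^sup>\<star> \<preceq> a\<^sup>\<star>
    \<and> leps \<^bold>+ a\<^sup>\<star> \<^bold>\<cdot> a \<preceq> a\<^sup>\<star>
    \<and> (b \<^bold>+ a \<^bold>\<cdot> x \<preceq> x \<longrightarrow> a\<^sup>\<star> \<^bold>\<cdot> b \<preceq> x)
    \<and> (b \<^bold>+ x \<^bold>\<cdot> a \<preceq> x \<longrightarrow> b \<^bold>\<cdot> a\<^sup>\<star> \<preceq> x)"
  \<comment> \<open>\<open>assumption\<close> closes the premises of the two induction laws; the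
    remaining equations become statements about splitting words.\<close>
  by (intro conjI impI lconcat_assoc lstar_unfold_left lstar_unfold_right lstar_induct_left
      lstar_induct_right; (assumption | rule lang_eqI))
    (auto simp: accepts_lconcat)

end
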